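(* Let $a_1,a_2,a_3$ be real parameters, let $\gamma>0$ and $\kappa(t)=e^{-\gamma t}$ for $t\ge 0$, and let $\sigma_1,\sigma_2,\sigma_3$ be the Pauli matrices. Consider the family of operators $$K_0(t;a_1,a_2,a_3)=\sqrt{1-(a_1+a_2+a_3)(1-\kappa(t))}\;\mathbb{I}_2,\qquad K_i(t;a_i)=\sqrt{a_i(1-\kappa(t))}\;\sigma_i\quad (i=1,2,3).$$ This family is a (three-parametric) non-degenerate family of Kraus operators only if $$a_1+a_2+a_3\le 1,\qquad a_1,a_2,a_3\ge 0,\qquad a_1,a_2,a_3 \text{ are pairwise distinct}.$$ Moreover, provided $(a_1,a_2,a_3)$ satisfy these conditions, the associated generator of evolution $$\mathbb{L}=\gamma\left(a_1\,\sigma_1\otimes\sigma_1+a_2\,\sigma_2^T\otimes\sigma_2+a_3\,\sigma_3\otimes\sigma_3-(a_1+a_2+a_3)\,\mathbb{I}_4\right)$$ has no degenerate eigenvalues, i.e. it has four distinct eigenvalues.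
   Context: The Pauli matrices are $\sigma_1=\begin{pmatrix}0&1\\1&0\end{pmatrix}$, $\sigma_2=\begin{pmatrix}0&-i\\ i&0\end{pmatrix}$, $\sigma_3=\begin{pmatrix}1&0\\0&-1\end{pmatrix}$; $\mathbb{I}_d$ is the $d\times d$ identity matrix, $\otimes$ is the Kronecker product, and $X^T$ is the transpose. The family $\{K_i\}_{i=0}^3$ is a family of Kraus operators (a quantum channel) if, for every $t\ge 0$, all the quantities under the square roots are non-negative real numbers, and $\sum_{i=0}^3 K_i^*K_i=\mathbb{I}_2$; it then defines the completely positive trace-preserving map $\rho\mapsto\sum_i K_i\rho K_i^*$ on $2\times2$ matrices. The generator of evolution associated with it is the linear map $\rho\mapsto\gamma\left(\sum_{i=1}^3 a_i\sigma_i\rho\sigma_i-(a_1+a_2+a_3)\rho\right)$ on $2\times 2$ complex matrices, whose matrix under column-stacking vectorization (using $\mathrm{vec}(XYZ)=(Z^T\otimes X)\,\mathrm{vec}\,Y$) is the $4\times4$ matrix $\mathbb{L}$ displayed in the claim. The family is called a non-degenerate family of Kraus operators if it is a family of Kraus operators (that is, for every $t\ge 0$, all the quantities under the square roots are non-negative real numbers and $\sum_{i=0}^3 K_i^*K_i=\mathbb{I}_2$) and the generator $\mathbb{L}$ has no degenerate eigenvalues, i.e. all $4$ of its eigenvalues are distinct. *)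

theory Defs
  imports Complex_Main "Jordan_Normal_Form.Spectral_Radius"
    "Jordan_Normal_Form.Schur_Decomposition"
begin

definition sigma1 :: "complex mat" where
  "sigma1 = mat_of_rows_list 2 [[0, 1], [1, 0]]"

definition sigma2 :: "complex mat" where
  "sigma2 = mat_of_rows_list 2 [[0, - \<i>], [\<i>, 0]]"

definition sigma3 :: "complex mat" where
  "sigma3 = mat_of_rows_list 2 [[1, 0], [0, - 1]]"

definition kronecker :: "'a::times mat \<Rightarrow> 'a mat \<Rightarrow> 'a mat" where
  "kronecker A B = mat (dim_row A * dim_row B) (dim_col A * dim_col B)
     (\<lambda>(i, j). A $$ (i div dim_row B, j div dim_col B) * B $$ (i mod dim_row B, j mod dim_col B))"

definition kappa :: "real \<Rightarrow> real \<Rightarrow> real" where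
  "kappa \<gamma> t = exp (- \<gamma> * t)"

text \<open>The quantities under the square roots. They are kept as separate real functions because the
  real square root of Isabelle is total, with negative values at negative arguments.\<close>

definition radicand0 :: "real \<Rightarrow> real \<Rightarrow> real \<Rightarrow> real \<Rightarrow> real \<Rightarrow> real" where
  "radicand0 \<gamma> a1 a2 a3 t = 1 - (a1 + a2 + a3) * (1 - kappa \<gamma> t)"

definition radicand :: "real \<Rightarrow> real \<Rightarrow> real \<Rightarrow> real" where
  "radicand \<gamma> a t = a * (1 - kappa \<gamma> t)"

definition K0 :: "real \<Rightarrow> real \<Rightarrow> real \<Rightarrow> real \<Rightarrow> real \<Rightarrow> complex mat" where
  "K0 \<gamma> a1 a2 a3 t = complex_of_real (sqrt (radicand0 \<gamma> a1 a2 a3 t)) \<cdot>\<^sub>m 1\<^sub>m 2"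

definition K1 :: "real \<Rightarrow> real \<Rightarrow> real \<Rightarrow> complex mat" where
  "K1 \<gamma> a1 t = complex_of_real (sqrt (radicand \<gamma> a1 t)) \<cdot>\<^sub>m sigma1"

definition K2 :: "real \<Rightarrow> real \<Rightarrow> real \<Rightarrow> complex mat" where
  "K2 \<gamma> a2 t = complex_of_real (sqrt (radicand \<gamma> a2 t)) \<cdot>\<^sub>m sigma2"

definition K3 :: "real \<Rightarrow> real \<Rightarrow> real \<Rightarrow> complex mat" where
  "K3 \<gamma> a3 t = complex_of_real (sqrt (radicand \<gamma> a3 t)) \<cdot>\<^sub>m sigma3"

definition kraus_family :: "real \<Rightarrow> real \<Rightarrow> real \<Rightarrow> real \<Rightarrow> bool" where
  "kraus_family \<gamma> a1 a2 a3 \<longleftrightarrow>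
     (\<forall>t\<ge>0.
        radicand0 \<gamma> a1 a2 a3 t \<ge> 0 \<and>
        radicand \<gamma> a1 t \<ge> 0 \<and> radicand \<gamma> a2 t \<ge> 0 \<and> radicand \<gamma> a3 t \<ge> 0 \<and>
        mat_adjoint (K0 \<gamma> a1 a2 a3 t) * K0 \<gamma> a1 a2 a3 t
        + mat_adjoint (K1 \<gamma> a1 t) * K1 \<gamma> a1 t
        + mat_adjoint (K2 \<gamma> a2 t) * K2 \<gamma> a2 t
        + mat_adjoint (K3 \<gamma> a3 t) * K3 \<gamma> a3 t = 1\<^sub>m 2)"

definition generator :: "real \<Rightarrow> real \<Rightarrow> real \<Rightarrow> real \<Rightarrow> complex mat \<Rightarrow> complex mat" where
  "generator \<gamma> a1 a2 a3 \<rho> = complex_of_real \<gamma> \<cdot>\<^sub>m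
     (complex_of_real a1 \<cdot>\<^sub>m (sigma1 * \<rho> * sigma1)
      + complex_of_real a2 \<cdot>\<^sub>m (sigma2 * \<rho> * sigma2)
      + complex_of_real a3 \<cdot>\<^sub>m (sigma3 * \<rho> * sigma3)
      - complex_of_real (a1 + a2 + a3) \<cdot>\<^sub>m \<rho>)"

definition generator_mat :: "real \<Rightarrow> real \<Rightarrow> real \<Rightarrow> real \<Rightarrow> complex mat" where
  "generator_mat \<gamma> a1 a2 a3 = complex_of_real \<gamma> \<cdot>\<^sub>m
     (complex_of_real a1 \<cdot>\<^sub>m kronecker sigma1 sigma1
      + complex_of_real a2 \<cdot>\<^sub>m kronecker (transpose_mat sigma2) sigma2
      + complex_of_real a3 \<cdot>\<^sub>m kronecker sigma3 sigma3
      - complex_of_real (a1 + a2 + a3) \<cdot>\<^sub>m 1\<^sub>m 4)"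

text \<open>Column-stacking vectorization.\<close>

definition vectorize :: "'a mat \<Rightarrow> 'a vec" where
  "vectorize A = vec (dim_row A * dim_col A) (\<lambda>k. A $$ (k mod dim_row A, k div dim_row A))"

lemma generator_mat_vectorize:
  assumes "\<rho> \<in> carrier_mat 2 2"
  shows "generator_mat \<gamma> a1 a2 a3 *\<^sub>v vectorize \<rho> = vectorize (generator \<gamma> a1 a2 a3 \<rho>)"
proof -
  have d: "dim_row \<rho> = 2" "dim_col \<rho> = 2" using assms by auto
  have *: "i = 0 \<or> i = 1 \<or> i = 2 \<or> i = 3" if "i < 4" for i :: nat using that by arith
  have s: "{0..<4} = {0, 1, 2, 3::nat}" "{0..<2} = {0, 1::nat}" by auto
  have p: "dim_row sigma1 = 2" "dim_col sigma1 = 2" "dim_row sigma2 = 2" "dim_col sigma2 = 2"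
    "dim_row sigma3 = 2" "dim_col sigma3 = 2"
    "sigma1 $$ (0, 0) = 0" "sigma1 $$ (0, Suc 0) = 1"
    "sigma1 $$ (Suc 0, 0) = 1" "sigma1 $$ (Suc 0, Suc 0) = 0"
    "sigma2 $$ (0, 0) = 0" "sigma2 $$ (0, Suc 0) = - \<i>"
    "sigma2 $$ (Suc 0, 0) = \<i>" "sigma2 $$ (Suc 0, Suc 0) = 0"
    "sigma3 $$ (0, 0) = 1" "sigma3 $$ (0, Suc 0) = 0"
    "sigma3 $$ (Suc 0, 0) = 0" "sigma3 $$ (Suc 0, Suc 0) = - 1"
    by (simp_all add: sigma1_def sigma2_def sigma3_def mat_of_rows_list_def)
  have q: "3 div 2 = Suc 0" "3 mod 2 = Suc 0" by simp_all
  show ?thesis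
    by (rule eq_vecI)
      (auto simp: p q d s generator_mat_def generator_def vectorize_def kronecker_def
        scalar_prod_def algebra_simps dest!: *)
qed

text \<open>No degenerate eigenvalues: an n by n matrix with n distinct eigenvalues.\<close>

definition nondegenerate_spectrum :: "complex mat \<Rightarrow> bool" where
  "nondegenerate_spectrum A \<longleftrightarrow> card (spectrum A) = dim_row A"

definition nondegenerate_kraus_family :: "real \<Rightarrow> real \<Rightarrow> real \<Rightarrow> real \<Rightarrow> bool" where
  "nondegenerate_kraus_family \<gamma> a1 a2 a3 \<longleftrightarrow>
     kraus_family \<gamma> a1 a2 a3 \<and> nondegenerate_spectrum (generator_mat \<gamma> a1 a2 a3)"

end

theory Submission
  imports Defs
begin

text \<open>The Pauli matrices diagonalise the generator: \<open>\<rho> = \<sigma>\<^sub>i\<close> is an eigenvector for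
  minus twice \<open>\<gamma>\<close> times the sum of the other two parameters, and \<open>\<rho> = \<I>\<close> is one for 0. So the
  spectrum is simple iff the pairwise sums of the parameters are distinct and nonzero. Positivity
  of the radicands for positive times gives the sign conditions, and letting time tend to
  infinity gives \<open>a\<^sub>1 + a\<^sub>2 + a\<^sub>3 \<le> 1\<close>.\<close>

text \<open>At a finite time the radicand only bounds the sum by
  \<open>1 / (1 - kappa \<gamma> t)\<close>, which exceeds 1, so the sharp bound comes from the
  limit of the radicand, \<open>1 - (a1 + a2 + a3)\<close>.\<close>

lemma sum_le_1_if_radicand0_nonneg:
  assumes "\<gamma> > 0" and nonneg: "\<And>t. t \<ge> 0 \<Longrightarrow> radicand0 \<gamma> a1 a2 a3 t \<ge> 0"
  shows "a1 + a2 + a3 \<le> 1"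
proof -
  \<comment> \<open>The exponential vanishes at minus infinity, and the exponent goes there because
    \<gamma> is positive.\<close>
  have "((\<lambda>t. exp (- (\<gamma> * t))) \<longlongrightarrow> 0) at_top"
    using \<open>\<gamma> > 0\<close>
    by (rule filterlim_compose[OF exp_at_bot,
          OF filterlim_compose[OF filterlim_uminus_at_bot_at_top],
          OF filterlim_tendsto_pos_mult_at_top[OF tendsto_const _ filterlim_ident]])
  then have "((\<lambda>t. 1 - (a1 + a2 + a3) * (1 - exp (- (\<gamma> * t)))) \<longlongrightarrow>
      1 - (a1 + a2 + a3) * (1 - 0)) at_top"
    by (intro tendsto_diff tendsto_mult tendsto_const)
  moreover have "eventually (\<lambda>t. 0 \<le> 1 - (a1 + a2 + a3) * (1 - exp (- (\<gamma> * t)))) at_top"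
    using eventually_ge_at_top[of 0]
    by eventually_elim (use nonneg in \<open>simp add: radicand0_def kappa_def\<close>)
  ultimately have "0 \<le> 1 - (a1 + a2 + a3) * (1 - 0)"
    by (rule tendsto_lowerbound) simp
  then show ?thesis by simp
qed

lemma nonneg_if_radicand_nonneg:
  assumes "\<gamma> > 0" "t > 0" "radicand \<gamma> a t \<ge> 0"
  shows "a \<ge> 0"
proof -
  have "1 - kappa \<gamma> t > 0"
    using assms(1,2) by (simp add: kappa_def)
  with assms(3) show ?thesis
    by (simp add: radicand_def zero_le_mult_iff)
qed

lemma generator_mat_carrier [simp]:
  "generator_mat \<gamma> a1 a2 a3 \<in> carrier_mat 4 4"
  unfolding generator_mat_def by (intro smult_carrier_mat minus_carrier_mat one_carrier_mat)

lemma vec_4_eq_iff: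
  assumes "dim_vec u = 4" "dim_vec v = 4"
  shows "u = v \<longleftrightarrow> u $ 0 = v $ 0 \<and> u $ 1 = v $ 1 \<and> u $ 2 = v $ 2 \<and> u $ 3 = v $ 3"
proof -
  have "(\<forall>i<4. P i) \<longleftrightarrow> P 0 \<and> P 1 \<and> P 2 \<and> P 3" for P :: "nat \<Rightarrow> bool"
    by (auto simp: numeral_eq_Suc All_less_Suc)
  with assms show ?thesis by (simp add: vec_eq_iff)
qed

lemma vCons_index_2_3:
  "vCons p (vCons q v) $ 2 = v $ 0" "vCons p (vCons q (vCons r v)) $ 3 = v $ 0"
  by (simp_all add: numeral_2_eq_2 numeral_3_eq_3)

text \<open>The coordinates 0 and 3 hold the diagonal entries of \<rho>, and 1 and 2 the
  off-diagonal ones. Conjugation by a Pauli matrix never mixes the two pairs, so the matrix splits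
  into two 2 by 2 blocks, each invariant under swapping its coordinates.\<close>

lemma generator_mat_mult_vec:
  fixes \<gamma> a1 a2 a3 :: real
  defines "b \<equiv> complex_of_real (\<gamma> * (a1 + a2))"
    and "c \<equiv> complex_of_real (\<gamma> * (a1 + a2 + 2 * a3))"
    and "d \<equiv> complex_of_real (\<gamma> * (a1 - a2))"
  assumes "v \<in> carrier_vec 4"
  shows "generator_mat \<gamma> a1 a2 a3 *\<^sub>v v = vec_of_list
    [b * (v $ 3 - v $ 0), d * v $ 2 - c * v $ 1, d * v $ 1 - c * v $ 2, b * (v $ 0 - v $ 3)]"
proof -
  have v: "dim_vec v = 4" using assms by auto
  have s: "{0..<4} = {0, 1, 2, 3::nat}" by auto
  have p: "dim_row sigma1 = 2" "dim_col sigma1 = 2" "dim_row sigma2 = 2" "dim_col sigma2 = 2"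
    "dim_row sigma3 = 2" "dim_col sigma3 = 2"
    "sigma1 $$ (0, 0) = 0" "sigma1 $$ (0, Suc 0) = 1"
    "sigma1 $$ (Suc 0, 0) = 1" "sigma1 $$ (Suc 0, Suc 0) = 0"
    "sigma2 $$ (0, 0) = 0" "sigma2 $$ (0, Suc 0) = - \<i>"
    "sigma2 $$ (Suc 0, 0) = \<i>" "sigma2 $$ (Suc 0, Suc 0) = 0"
    "sigma3 $$ (0, 0) = 1" "sigma3 $$ (0, Suc 0) = 0"
    "sigma3 $$ (Suc 0, 0) = 0" "sigma3 $$ (Suc 0, Suc 0) = - 1"
    by (simp_all add: sigma1_def sigma2_def sigma3_def mat_of_rows_list_def)
  have q: "3 div 2 = Suc 0" "3 mod 2 = Suc 0" by simp_all
  show ?thesis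
    by (subst vec_4_eq_iff)
      (simp_all add: p q v s b_def c_def d_def generator_mat_def kronecker_def
        vCons_index_2_3 scalar_prod_def algebra_simps)
qed

text \<open>Read coordinatewise, the eigenvector equation is a system of four scalar equations,
  which reduces the computation of the spectrum to elementary algebra.\<close>

lemma eigenvalue_generator_mat_iff:
  "eigenvalue (generator_mat \<gamma> a1 a2 a3) k \<longleftrightarrow>
    (\<exists>w x y z. (w, x, y, z) \<noteq> (0, 0, 0, 0) \<and>
      of_real (\<gamma> * (a1 + a2)) * (z - w) = k * w \<and>
      of_real (\<gamma> * (a1 - a2)) * y - of_real (\<gamma> * (a1 + a2 + 2 * a3)) * x = k * x \<and>
      of_real (\<gamma> * (a1 - a2)) * x - of_real (\<gamma> * (a1 + a2 + 2 * a3)) * y = k * y \<and>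
      of_real (\<gamma> * (a1 + a2)) * (w - z) = k * z)"
    (is "_ \<longleftrightarrow> (\<exists>w x y z. ?E w x y z)")
proof -
  have ev: "eigenvector (generator_mat \<gamma> a1 a2 a3) v k \<longleftrightarrow> ?E (v $ 0) (v $ 1) (v $ 2) (v $ 3)"
    if v: "v \<in> carrier_vec 4" for v
  proof -
    have "dim_row (generator_mat \<gamma> a1 a2 a3) = 4"
      using generator_mat_carrier by blast
    moreover have "v \<noteq> 0\<^sub>v 4 \<longleftrightarrow> (v $ 0, v $ 1, v $ 2, v $ 3) \<noteq> (0, 0, 0, 0)"
      using v by (subst vec_4_eq_iff) auto
    moreover have "generator_mat \<gamma> a1 a2 a3 *\<^sub>v v = k \<cdot>\<^sub>v v \<longleftrightarrow>
      of_real (\<gamma> * (a1 + a2)) * (v $ 3 - v $ 0) = k * v $ 0 \<and>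
      of_real (\<gamma> * (a1 - a2)) * v $ 2 - of_real (\<gamma> * (a1 + a2 + 2 * a3)) * v $ 1 = k * v $ 1 \<and>
      of_real (\<gamma> * (a1 - a2)) * v $ 1 - of_real (\<gamma> * (a1 + a2 + 2 * a3)) * v $ 2 = k * v $ 2 \<and>
      of_real (\<gamma> * (a1 + a2)) * (v $ 0 - v $ 3) = k * v $ 3"
      unfolding generator_mat_mult_vec[OF v] using v
      by (subst vec_4_eq_iff) (simp_all add: vCons_index_2_3)
    ultimately show ?thesis
      using v by (simp add: eigenvector_def)
  qed
  show ?thesis
  proof
    assume "eigenvalue (generator_mat \<gamma> a1 a2 a3) k"
    then obtain v where v: "eigenvector (generator_mat \<gamma> a1 a2 a3) v k"
      by (auto simp: eigenvalue_def)
    moreover have "v \<in> carrier_vec 4"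
      using v generator_mat_carrier[of \<gamma> a1 a2 a3] by (auto simp: eigenvector_def)
    ultimately show "\<exists>w x y z. ?E w x y z" using ev by blast
  next
    assume "\<exists>w x y z. ?E w x y z"
    then obtain w x y z where E: "?E w x y z" by blast
    define v where "v = vec_of_list [w, x, y, z]"
    have "v $ 0 = w" "v $ 1 = x" "v $ 2 = y" "v $ 3 = z"
      by (simp_all add: v_def vCons_index_2_3)
    moreover have "v \<in> carrier_vec 4" by (rule carrier_vecI) (simp add: v_def)
    ultimately have "eigenvector (generator_mat \<gamma> a1 a2 a3) v k"
      using E ev[of v] by metis
    then show "eigenvalue (generator_mat \<gamma> a1 a2 a3) k"
      by (auto simp: eigenvalue_def)
  qed
qed

text \<open>Swap symmetry of the two blocks makes the sum and the difference of paired coordinates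
  diagonalise the system: \<open>w + z\<close>, \<open>w - z\<close>, \<open>x + y\<close> and
  \<open>x - y\<close> are, up to scalars, the components along the identity, \<open>sigma3\<close>,
  \<open>sigma1\<close> and \<open>sigma2\<close>.\<close>

lemma spectrum_generator_mat:
  "spectrum (generator_mat \<gamma> a1 a2 a3) = of_real `
    {0, - 2 * \<gamma> * (a1 + a2), - 2 * \<gamma> * (a1 + a3), - 2 * \<gamma> * (a2 + a3)}" (is "_ = ?S")
proof (intro equalityI subsetI)
  fix k :: complex assume "k \<in> spectrum (generator_mat \<gamma> a1 a2 a3)"
  define b c d where "b = complex_of_real (\<gamma> * (a1 + a2))"
    and "c = complex_of_real (\<gamma> * (a1 + a2 + 2 * a3))"
    and "d = complex_of_real (\<gamma> * (a1 - a2))"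
  from \<open>k \<in> spectrum (generator_mat \<gamma> a1 a2 a3)\<close>
  obtain w x y z where nz: "(w, x, y, z) \<noteq> (0, 0, 0, 0)"
    and eqs: "b * (z - w) = k * w" "d * y - c * x = k * x" "d * x - c * y = k * y"
      "b * (w - z) = k * z"
    unfolding spectrum_def mem_Collect_eq eigenvalue_generator_mat_iff b_def c_def d_def
    by blast
  \<comment> \<open>The right-hand sides of these four identities are sums and differences of
    residuals of the eigenvalue equations, so rewriting with \<open>eqs\<close> turns them into
    0.\<close>
  have "k * (w + z) = (k * w - b * (z - w)) + (k * z - b * (w - z))"
    by (simp add: algebra_simps)
  moreover have "(k + 2 * b) * (w - z) = (k * w - b * (z - w)) - (k * z - b * (w - z))"
    by (simp add: algebra_simps)
  moreover have "(k + c - d) * (x + y) =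
      (k * x - (d * y - c * x)) + (k * y - (d * x - c * y))"
    by (simp add: algebra_simps)
  moreover have "(k + c + d) * (x - y) =
      (k * x - (d * y - c * x)) - (k * y - (d * x - c * y))"
    by (simp add: algebra_simps)
  \<comment> \<open>A pair whose sum and difference both vanish is zero, so a nonzero eigenvector
    leaves some product with a nonzero second factor, which forces the first one to vanish.\<close>
  moreover have "w + z \<noteq> 0 \<or> w - z \<noteq> 0 \<or> x + y \<noteq> 0 \<or> x - y \<noteq> 0"
    using nz by auto
  ultimately have "k = 0 \<or> k + 2 * b = 0 \<or> k + c - d = 0 \<or> k + c + d = 0"
    unfolding eqs diff_self add_0 mult_eq_0_iff by blast
  then have "k = 0 \<or> k = - (2 * b) \<or> k = d - c \<or> k = - c - d"
    by (simp add: algebra_simps eq_neg_iff_add_eq_0)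
  moreover have "- (2 * b) = of_real (- 2 * \<gamma> * (a1 + a2))"
    "d - c = of_real (- 2 * \<gamma> * (a2 + a3))" "- c - d = of_real (- 2 * \<gamma> * (a1 + a3))"
    unfolding b_def c_def d_def of_real_minus[symmetric] of_real_diff[symmetric]
    by (simp_all add: algebra_simps)
  ultimately show "k \<in> ?S"
    unfolding image_insert image_empty of_real_0 by blast
next
  fix k :: complex assume "k \<in> ?S"
  then consider "k = 0" | "k = of_real (- 2 * \<gamma> * (a1 + a2))"
    | "k = of_real (- 2 * \<gamma> * (a1 + a3))" | "k = of_real (- 2 * \<gamma> * (a2 + a3))"
    by auto
  \<comment> \<open>The witnesses in the four cases are, up to a scalar, the vectorizations of the
    identity, \<open>sigma3\<close>, \<open>sigma2\<close> and \<open>sigma1\<close>.\<close>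
  then have "eigenvalue (generator_mat \<gamma> a1 a2 a3) k"
  proof cases
    case 1
    show ?thesis
      by (unfold eigenvalue_generator_mat_iff,
        rule exI[of _ 1], rule exI[of _ 0], rule exI[of _ 0], rule exI[of _ 1])
        (simp add: 1)
  next
    case 2
    show ?thesis
      by (unfold eigenvalue_generator_mat_iff,
        rule exI[of _ 1], rule exI[of _ 0], rule exI[of _ 0], rule exI[of _ "- 1"])
        (simp add: 2 algebra_simps)
  next
    case 3
    show ?thesis
      by (unfold eigenvalue_generator_mat_iff,
        rule exI[of _ 0], rule exI[of _ 1], rule exI[of _ "- 1"], rule exI[of _ 0])
        (simp add: 3 algebra_simps)
  next
    case 4
    show ?thesis
      by (unfold eigenvalue_generator_mat_iff,
        rule exI[of _ 0], rule exI[of _ 1], rule exI[of _ 1], rule exI[of _ 0])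
        (simp add: 4 algebra_simps)
  qed
  then show "k \<in> spectrum (generator_mat \<gamma> a1 a2 a3)"
    by (simp add: spectrum_def)
qed

text \<open>Two pairwise sums share a parameter, so they differ exactly when the other two
  parameters do; being nonzero separates them from the eigenvalue 0.\<close>

lemma nondegenerate_spectrum_generator_mat_iff:
  assumes "\<gamma> \<noteq> 0"
  shows "nondegenerate_spectrum (generator_mat \<gamma> a1 a2 a3) \<longleftrightarrow>
    a1 + a2 \<noteq> 0 \<and> a1 + a3 \<noteq> 0 \<and> a2 + a3 \<noteq> 0 \<and> a1 \<noteq> a2 \<and> a1 \<noteq> a3 \<and> a2 \<noteq> a3"
proof -
  have dim: "dim_row (generator_mat \<gamma> a1 a2 a3) = 4"
    using generator_mat_carrier by blast
  \<comment> \<open>As a list, the eigenvalues keep their multiplicity: the set has 4 elements iff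
    the list of length 4 is distinct.\<close>
  define xs where "xs = [0, - 2 * \<gamma> * (a1 + a2), - 2 * \<gamma> * (a1 + a3), - 2 * \<gamma> * (a2 + a3)]"
  have "spectrum (generator_mat \<gamma> a1 a2 a3) = of_real ` set xs"
    unfolding spectrum_generator_mat xs_def by (simp only: list.set)
  then have "card (spectrum (generator_mat \<gamma> a1 a2 a3)) = card (set xs)"
    by (simp add: card_image inj_on_def)
  moreover have "length xs = 4" by (simp add: xs_def)
  ultimately have "nondegenerate_spectrum (generator_mat \<gamma> a1 a2 a3) \<longleftrightarrow> distinct xs"
    unfolding nondegenerate_spectrum_def dim by (metis card_distinct distinct_card)
  also have "\<dots> \<longleftrightarrow> a1 + a2 \<noteq> 0 \<and> a1 + a3 \<noteq> 0 \<and> a2 + a3 \<noteq> 0 \<and> a1 \<noteq> a2 \<and> a1 \<noteq> a3 \<and> a2 \<noteq> a3"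
  proof -
    have "xs = map ((*) (- 2 * \<gamma>)) [0, a1 + a2, a1 + a3, a2 + a3]"
      by (simp add: xs_def)
    moreover have "inj ((*) (- 2 * \<gamma>))"
      using assms by (simp add: inj_on_def)
    ultimately have "distinct xs \<longleftrightarrow> distinct [0, a1 + a2, a1 + a3, a2 + a3]"
      by (metis distinct_map inj_on_subset subset_UNIV)
    then show ?thesis by auto
  qed
  finally show ?thesis .
qed

theorem theorem2p1:
  fixes \<gamma> a1 a2 a3 :: real
  assumes "\<gamma> > 0"
  shows "(nondegenerate_kraus_family \<gamma> a1 a2 a3 \<longrightarrow>
      a1 + a2 + a3 \<le> 1 \<and> a1 \<ge> 0 \<and> a2 \<ge> 0 \<and> a3 \<ge> 0 \<and> a1 \<noteq> a2 \<and> a1 \<noteq> a3 \<and> a2 \<noteq> a3) \<and>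
    (a1 + a2 + a3 \<le> 1 \<and> a1 \<ge> 0 \<and> a2 \<ge> 0 \<and> a3 \<ge> 0 \<and> a1 \<noteq> a2 \<and> a1 \<noteq> a3 \<and> a2 \<noteq> a3 \<longrightarrow>
      nondegenerate_spectrum (generator_mat \<gamma> a1 a2 a3))"
proof (intro conjI impI)
  assume "nondegenerate_kraus_family \<gamma> a1 a2 a3"
  then have kraus: "kraus_family \<gamma> a1 a2 a3"
    and spec: "nondegenerate_spectrum (generator_mat \<gamma> a1 a2 a3)"
    by (auto simp: nondegenerate_kraus_family_def)
  show "a1 + a2 + a3 \<le> 1"
    using kraus assms by (intro sum_le_1_if_radicand0_nonneg) (auto simp: kraus_family_def)
  \<comment> \<open>Any positive time serves here; at time 0 the radicands vanish and say nothing
    about the signs.\<close>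
  have "radicand \<gamma> a1 1 \<ge> 0 \<and> radicand \<gamma> a2 1 \<ge> 0 \<and> radicand \<gamma> a3 1 \<ge> 0"
    using kraus zero_le_one unfolding kraus_family_def by blast
  then show "a1 \<ge> 0" "a2 \<ge> 0" "a3 \<ge> 0"
    by (simp_all add: nonneg_if_radicand_nonneg[OF assms, of 1])
  show "a1 \<noteq> a2" "a1 \<noteq> a3" "a2 \<noteq> a3"
    using spec assms by (auto simp: nondegenerate_spectrum_generator_mat_iff)
next
  assume "a1 + a2 + a3 \<le> 1 \<and> a1 \<ge> 0 \<and> a2 \<ge> 0 \<and> a3 \<ge> 0 \<and> a1 \<noteq> a2 \<and> a1 \<noteq> a3 \<and> a2 \<noteq> a3"
  \<comment> \<open>Of two distinct nonnegative numbers at least one is positive, hence so is their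
    sum.\<close>
  moreover from this have "a1 + a2 \<noteq> 0 \<and> a1 + a3 \<noteq> 0 \<and> a2 + a3 \<noteq> 0"
    by linarith
  ultimately show "nondegenerate_spectrum (generator_mat \<gamma> a1 a2 a3)"
    using assms by (simp add: nondegenerate_spectrum_generator_mat_iff)
qed

end
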